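(* Let $\mathsf{HoGph}$ be the category whose objects are graphs and whose morphisms $G\to H$ are homotopy classes $[f]$ of graph morphisms $f:G\to H$, with composition $[g][f]=[gf]$, and let $\Psi:\mathsf{Gph}\to\mathsf{HoGph}$ be the functor that is the identity on objects and sends $f$ to $[f]$. Then for every category $\mathcal{C}$ and every functor $F:\mathsf{Gph}\to\mathcal{C}$ that sends homotopy equivalences to isomorphisms, there is a unique functor $F':\mathsf{HoGph}\to\mathcal{C}$ with $F'\Psi=F$.
   Context: $\mathsf{Gph}$ is the category of graphs (finite undirected graphs, loops allowed, at most one edge between two vertices) and graph morphisms (vertex maps preserving edges). The exponential graph $H^G$ has as vertices the set maps $V(G)\to V(H)$, with $f\text{---}g$ iff $f(v_1)\text{---}g(v_2)$ for every edge $v_1\text{---}v_2$ of $G$ (loops included). Morphisms $f,g:G\to H$ are homotopic if there is a sequence of graph morphisms $f=f_0,\dots,f_n=g$ with $f_i\text{---}f_{i+1}$ in $H^G$; this is an equivalence relation compatible with composition, and $[f]$ denotes the class of $f$. A morphism $f:G\to H$ is a homotopy equivalence if there is $g:H\to G$ with $gf$ homotopic to $\mathrm{id}_G$ and $fg$ homotopic to $\mathrm{id}_H$. *)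

theory Defs
  imports "HOL-Library.FuncSet"
begin

section \<open>Categories and functors\<close>

text \<open>
  A category is given by its objects, its hom-sets, identities and composition;
  \<open>Comp C X Y Z g f\<close> is the composite of \<open>f : X \<rightarrow> Y\<close> and \<open>g : Y \<rightarrow> Z\<close>. All operations are
  indexed by objects, so hom-sets for different pairs of objects need not be disjoint.
\<close>

record ('o, 'm) category_data =
  Obj :: "'o set"
  Hom :: "'o \<Rightarrow> 'o \<Rightarrow> 'm set"
  Id :: "'o \<Rightarrow> 'm"
  Comp :: "'o \<Rightarrow> 'o \<Rightarrow> 'o \<Rightarrow> 'm \<Rightarrow> 'm \<Rightarrow> 'm"

definition is_category :: "('o, 'm) category_data \<Rightarrow> bool" where
  "is_category C \<longleftrightarrow>
     (\<forall>X\<in>Obj C. Id C X \<in> Hom C X X) \<and>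
     (\<forall>X\<in>Obj C. \<forall>Y\<in>Obj C. \<forall>Z\<in>Obj C. \<forall>f\<in>Hom C X Y. \<forall>g\<in>Hom C Y Z.
        Comp C X Y Z g f \<in> Hom C X Z) \<and>
     (\<forall>X\<in>Obj C. \<forall>Y\<in>Obj C. \<forall>f\<in>Hom C X Y.
        Comp C X X Y f (Id C X) = f \<and> Comp C X Y Y (Id C Y) f = f) \<and>
     (\<forall>W\<in>Obj C. \<forall>X\<in>Obj C. \<forall>Y\<in>Obj C. \<forall>Z\<in>Obj C.
        \<forall>f\<in>Hom C W X. \<forall>g\<in>Hom C X Y. \<forall>h\<in>Hom C Y Z.
        Comp C W Y Z h (Comp C W X Y g f) = Comp C W X Z (Comp C X Y Z h g) f)"

definition is_iso :: "('o, 'm) category_data \<Rightarrow> 'o \<Rightarrow> 'o \<Rightarrow> 'm \<Rightarrow> bool" where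
  "is_iso C X Y f \<longleftrightarrow> f \<in> Hom C X Y \<and>
     (\<exists>g\<in>Hom C Y X. Comp C X Y X g f = Id C X \<and> Comp C Y X Y f g = Id C Y)"

record ('o, 'm, 'p, 'n) functor_data =
  FObj :: "'o \<Rightarrow> 'p"
  FArr :: "'o \<Rightarrow> 'o \<Rightarrow> 'm \<Rightarrow> 'n"

text \<open>
  The object and arrow maps are required to be \<^const>\<open>undefined\<close> outside the objects and
  morphisms of the source category, so that equality in HOL of the data is equality of functors.
\<close>

definition is_functor ::
  "('o, 'm) category_data \<Rightarrow> ('p, 'n) category_data \<Rightarrow> ('o, 'm, 'p, 'n) functor_data \<Rightarrow> bool" where
  "is_functor A B F \<longleftrightarrow>
     FObj F \<in> Obj A \<rightarrow>\<^sub>E Obj B \<and>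
     (\<forall>X\<in>Obj A. \<forall>Y\<in>Obj A. FArr F X Y \<in> Hom A X Y \<rightarrow>\<^sub>E Hom B (FObj F X) (FObj F Y)) \<and>
     (\<forall>X Y. X \<notin> Obj A \<or> Y \<notin> Obj A \<longrightarrow> FArr F X Y = (\<lambda>_. undefined)) \<and>
     (\<forall>X\<in>Obj A. FArr F X X (Id A X) = Id B (FObj F X)) \<and>
     (\<forall>X\<in>Obj A. \<forall>Y\<in>Obj A. \<forall>Z\<in>Obj A. \<forall>f\<in>Hom A X Y. \<forall>g\<in>Hom A Y Z.
        FArr F X Z (Comp A X Y Z g f) =
          Comp B (FObj F X) (FObj F Y) (FObj F Z) (FArr F Y Z g) (FArr F X Y f))"

definition comp_functor ::
  "('o, 'm) category_data \<Rightarrow> ('p, 'n, 'q, 'l) functor_data \<Rightarrow> ('o, 'm, 'p, 'n) functor_data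
     \<Rightarrow> ('o, 'm, 'q, 'l) functor_data" where
  "comp_functor A G F =
     \<lparr>FObj = (\<lambda>X\<in>Obj A. FObj G (FObj F X)),
      FArr = (\<lambda>X Y f. if X \<in> Obj A \<and> Y \<in> Obj A \<and> f \<in> Hom A X Y
                      then FArr G (FObj F X) (FObj F Y) (FArr F X Y f) else undefined)\<rparr>"

lemma is_functor_comp_functor:
  assumes A: "is_category A" and F: "is_functor A B F" and G: "is_functor B C G"
  shows "is_functor A C (comp_functor A G F)"
proof -
  have obj: "FObj F X \<in> Obj B" if "X \<in> Obj A" for X
    using F that by (auto simp: is_functor_def)
  have arr: "FArr F X Y f \<in> Hom B (FObj F X) (FObj F Y)"
    if "X \<in> Obj A" "Y \<in> Obj A" "f \<in> Hom A X Y" for X Y f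
    using F that unfolding is_functor_def by blast
  have obj': "FObj G X \<in> Obj C" if "X \<in> Obj B" for X
    using G that by (auto simp: is_functor_def)
  have arr': "FArr G X Y f \<in> Hom C (FObj G X) (FObj G Y)"
    if "X \<in> Obj B" "Y \<in> Obj B" "f \<in> Hom B X Y" for X Y f
    using G that unfolding is_functor_def by blast
  have ids: "Id A X \<in> Hom A X X" if "X \<in> Obj A" for X
    using A that by (auto simp: is_category_def)
  have comps: "Comp A X Y Z g f \<in> Hom A X Z"
    if "X \<in> Obj A" "Y \<in> Obj A" "Z \<in> Obj A" "f \<in> Hom A X Y" "g \<in> Hom A Y Z" for X Y Z f g
    using A that unfolding is_category_def by blast
  have F_id: "FArr F X X (Id A X) = Id B (FObj F X)" if "X \<in> Obj A" for X
    using F that by (auto simp: is_functor_def)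
  have G_id: "FArr G X X (Id B X) = Id C (FObj G X)" if "X \<in> Obj B" for X
    using G that by (auto simp: is_functor_def)
  have F_comp: "FArr F X Z (Comp A X Y Z g f) =
      Comp B (FObj F X) (FObj F Y) (FObj F Z) (FArr F Y Z g) (FArr F X Y f)"
    if "X \<in> Obj A" "Y \<in> Obj A" "Z \<in> Obj A" "f \<in> Hom A X Y" "g \<in> Hom A Y Z" for X Y Z f g
    using F that unfolding is_functor_def by blast
  have G_comp: "FArr G X Z (Comp B X Y Z g f) =
      Comp C (FObj G X) (FObj G Y) (FObj G Z) (FArr G Y Z g) (FArr G X Y f)"
    if "X \<in> Obj B" "Y \<in> Obj B" "Z \<in> Obj B" "f \<in> Hom B X Y" "g \<in> Hom B Y Z" for X Y Z f g
    using G that unfolding is_functor_def by blast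
  show ?thesis
    unfolding is_functor_def comp_functor_def
    by (auto simp: PiE_iff extensional_def fun_eq_iff obj arr obj' arr' ids comps F_id G_id F_comp G_comp)
qed

section \<open>Graphs\<close>

record 'v graph =
  verts :: "'v set"
  edges :: "('v \<times> 'v) set"

text \<open>
  An undirected edge is represented by its two orientations; loops are allowed.
\<close>

definition is_graph :: "'v graph \<Rightarrow> bool" where
  "is_graph G \<longleftrightarrow> finite (verts G) \<and> edges G \<subseteq> verts G \<times> verts G \<and> sym (edges G)"

definition graph_hom :: "'v graph \<Rightarrow> 'w graph \<Rightarrow> ('v \<Rightarrow> 'w) set" where
  "graph_hom G H =
     {f \<in> verts G \<rightarrow>\<^sub>E verts H. \<forall>v1 v2. (v1, v2) \<in> edges G \<longrightarrow> (f v1, f v2) \<in> edges H}"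

text \<open>The exponential graph \<open>H\<^sup>G\<close>.\<close>

definition exp_graph :: "'w graph \<Rightarrow> 'v graph \<Rightarrow> ('v \<Rightarrow> 'w) graph" where
  "exp_graph H G =
     \<lparr>verts = verts G \<rightarrow>\<^sub>E verts H,
      edges = {(f, g). f \<in> verts G \<rightarrow>\<^sub>E verts H \<and> g \<in> verts G \<rightarrow>\<^sub>E verts H \<and>
                 (\<forall>v1 v2. (v1, v2) \<in> edges G \<longrightarrow> (f v1, g v2) \<in> edges H)}\<rparr>"

lemma is_graph_exp_graph:
  assumes "is_graph G" "is_graph H"
  shows "is_graph (exp_graph H G)"
  using assms unfolding is_graph_def exp_graph_def sym_def
  by (auto intro!: finite_PiE)

definition homotopic :: "'v graph \<Rightarrow> 'w graph \<Rightarrow> ('v \<Rightarrow> 'w) \<Rightarrow> ('v \<Rightarrow> 'w) \<Rightarrow> bool" where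
  "homotopic G H f g \<longleftrightarrow>
     (\<exists>(n::nat) s. s 0 = f \<and> s n = g \<and> (\<forall>i\<le>n. s i \<in> graph_hom G H) \<and>
        (\<forall>i<n. (s i, s (Suc i)) \<in> edges (exp_graph H G)))"

definition homotopy_equivalence :: "'v graph \<Rightarrow> 'w graph \<Rightarrow> ('v \<Rightarrow> 'w) \<Rightarrow> bool" where
  "homotopy_equivalence G H f \<longleftrightarrow> f \<in> graph_hom G H \<and>
     (\<exists>g\<in>graph_hom H G.
        homotopic G G (compose (verts G) g f) (\<lambda>v\<in>verts G. v) \<and>
        homotopic H H (compose (verts H) f g) (\<lambda>w\<in>verts H. w))"

definition homotopy_rel :: "'v graph \<Rightarrow> 'w graph \<Rightarrow> (('v \<Rightarrow> 'w) \<times> ('v \<Rightarrow> 'w)) set" where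
  "homotopy_rel G H = {(f, g). homotopic G H f g}"

definition homotopy_class :: "'v graph \<Rightarrow> 'w graph \<Rightarrow> ('v \<Rightarrow> 'w) \<Rightarrow> ('v \<Rightarrow> 'w) set" where
  "homotopy_class G H f = homotopy_rel G H `` {f}"

section \<open>The categories of graphs and of graphs up to homotopy\<close>

text \<open>
  The objects are the finite graphs with vertices in the type \<open>'v\<close>, which plays the role of the
  universe of vertices. Every finite graph occurs up to isomorphism when \<open>'v\<close> is infinite.
\<close>

definition Gph :: "('v graph, 'v \<Rightarrow> 'v) category_data" where
  "Gph =
     \<lparr>Obj = {G. is_graph G},
      Hom = graph_hom,
      Id = (\<lambda>G. \<lambda>v\<in>verts G. v),
      Comp = (\<lambda>G H K g f. compose (verts G) g f)\<rparr>"

text \<open>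
  The union below is over pairs of representatives; by \<open>HoGph_Comp_class\<close> it equals the
  class of the composite of any two of them.
\<close>

definition HoGph :: "('v graph, ('v \<Rightarrow> 'v) set) category_data" where
  "HoGph =
     \<lparr>Obj = {G. is_graph G},
      Hom = (\<lambda>G H. graph_hom G H // homotopy_rel G H),
      Id = (\<lambda>G. homotopy_class G G (\<lambda>v\<in>verts G. v)),
      Comp = (\<lambda>G H K b a. \<Union>g\<in>b. \<Union>f\<in>a. homotopy_class G K (compose (verts G) g f))\<rparr>"

definition Psi :: "('v graph, 'v \<Rightarrow> 'v, 'v graph, ('v \<Rightarrow> 'v) set) functor_data" where
  "Psi =
     \<lparr>FObj = (\<lambda>G\<in>Obj Gph. G),
      FArr = (\<lambda>G H f. if G \<in> Obj Gph \<and> H \<in> Obj Gph \<and> f \<in> Hom Gph G H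
                      then homotopy_class G H f else undefined)\<rparr>"

lemma homotopic_iff_rtrancl:
  "homotopic G H f g \<longleftrightarrow> f \<in> graph_hom G H \<and>
     (f, g) \<in> (edges (exp_graph H G) \<inter> graph_hom G H \<times> graph_hom G H)\<^sup>*"
  (is "_ \<longleftrightarrow> _ \<and> _ \<in> ?R\<^sup>*")
proof
  assume "homotopic G H f g"
  then obtain n :: nat and s where s: "s 0 = f" "s n = g" "\<And>i. i \<le> n \<Longrightarrow> s i \<in> graph_hom G H"
    "\<And>i. i < n \<Longrightarrow> (s i, s (Suc i)) \<in> edges (exp_graph H G)"
    unfolding homotopic_def by blast
  then have "\<forall>i<n. (s i, s (Suc i)) \<in> ?R"
    by simp
  with s have "(f, g) \<in> ?R ^^ n"
    unfolding relpow_fun_conv by blast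
  with s(1) s(3)[of 0] show "f \<in> graph_hom G H \<and> (f, g) \<in> ?R\<^sup>*"
    using relpow_imp_rtrancl by auto
next
  assume fg: "f \<in> graph_hom G H \<and> (f, g) \<in> ?R\<^sup>*"
  then obtain n where "(f, g) \<in> ?R ^^ n"
    using rtrancl_imp_relpow by blast
  then obtain s where s: "s 0 = f" "s n = g" "\<forall>i<n. (s i, s (Suc i)) \<in> ?R"
    unfolding relpow_fun_conv by blast
  have "s i \<in> graph_hom G H" if "i \<le> n" for i
    using that s fg by (cases i) (auto simp: Suc_le_eq)
  with s show "homotopic G H f g"
    unfolding homotopic_def by blast
qed

lemma homotopic_hom: "homotopic G H f g \<Longrightarrow> f \<in> graph_hom G H \<and> g \<in> graph_hom G H"
  unfolding homotopic_def by (metis le0 order_refl)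

lemma homotopic_refl: "f \<in> graph_hom G H \<Longrightarrow> homotopic G H f f"
  by (simp add: homotopic_iff_rtrancl)

lemma homotopic_trans: "homotopic G H f g \<Longrightarrow> homotopic G H g h \<Longrightarrow> homotopic G H f h"
  by (auto simp: homotopic_iff_rtrancl)

lemma homotopic_sym:
  assumes "is_graph G" "is_graph H" "homotopic G H f g"
  shows "homotopic G H g f"
proof -
  have "sym (edges (exp_graph H G))"
    using is_graph_exp_graph[OF assms(1,2)] by (simp add: is_graph_def)
  then have "sym (edges (exp_graph H G) \<inter> graph_hom G H \<times> graph_hom G H)"
    by (auto simp: sym_def)
  then have "sym ((edges (exp_graph H G) \<inter> graph_hom G H \<times> graph_hom G H)\<^sup>*)"
    by (rule sym_rtrancl)
  with assms(3) homotopic_hom[OF assms(3)] show ?thesis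
    by (auto simp: homotopic_iff_rtrancl dest: symD)
qed

lemma equiv_homotopy_rel:
  assumes "is_graph G" "is_graph H"
  shows "equiv (graph_hom G H) (homotopy_rel G H)"
  unfolding homotopy_rel_def
  by (rule equivI)
     (auto simp: refl_on_def intro!: symI transI homotopic_refl
           intro: homotopic_trans homotopic_sym[OF assms] dest: homotopic_hom)

lemma graph_hom_id: "is_graph G \<Longrightarrow> (\<lambda>v\<in>verts G. v) \<in> graph_hom G G"
  by (auto simp: graph_hom_def is_graph_def)

lemma graph_hom_compose:
  assumes "is_graph G" "f \<in> graph_hom G H" "g \<in> graph_hom H K"
  shows "compose (verts G) g f \<in> graph_hom G K"
  using assms by (auto simp: graph_hom_def is_graph_def compose_def PiE_iff)

lemma homotopic_compose_right:
  assumes G: "is_graph G" and f: "f \<in> graph_hom G H" and gg': "homotopic H K g g'"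
  shows "homotopic G K (compose (verts G) g f) (compose (verts G) g' f)"
proof -
  obtain n :: nat and s where s: "s 0 = g" "s n = g'" "\<forall>i\<le>n. s i \<in> graph_hom H K"
    "\<forall>i<n. (s i, s (Suc i)) \<in> edges (exp_graph K H)"
    using gg' unfolding homotopic_def by blast
  have "(compose (verts G) (s i) f, compose (verts G) (s (Suc i)) f) \<in> edges (exp_graph K G)"
    if "i < n" for i
  proof -
    have "(s i, s (Suc i)) \<in> edges (exp_graph K H)"
      using s that by blast
    then show ?thesis
      using G f by (auto simp: exp_graph_def graph_hom_def is_graph_def compose_def PiE_iff)
  qed
  moreover have "\<forall>i\<le>n. compose (verts G) (s i) f \<in> graph_hom G K"
    using s graph_hom_compose[OF G f] by blast
  ultimately show ?thesis
    unfolding homotopic_def using s(1,2)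
    by (intro exI[of _ n] exI[of _ "\<lambda>i. compose (verts G) (s i) f"]) auto
qed

lemma homotopic_compose_left:
  assumes G: "is_graph G" and ff': "homotopic G H f f'" and g: "g \<in> graph_hom H K"
  shows "homotopic G K (compose (verts G) g f) (compose (verts G) g f')"
proof -
  obtain n :: nat and s where s: "s 0 = f" "s n = f'" "\<forall>i\<le>n. s i \<in> graph_hom G H"
    "\<forall>i<n. (s i, s (Suc i)) \<in> edges (exp_graph H G)"
    using ff' unfolding homotopic_def by blast
  have "(compose (verts G) g (s i), compose (verts G) g (s (Suc i))) \<in> edges (exp_graph K G)"
    if "i < n" for i
  proof -
    have "(s i, s (Suc i)) \<in> edges (exp_graph H G)"
      using s that by blast
    then show ?thesis
      using G g by (auto simp: exp_graph_def graph_hom_def is_graph_def compose_def PiE_iff)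
  qed
  moreover have "\<forall>i\<le>n. compose (verts G) g (s i) \<in> graph_hom G K"
    using s graph_hom_compose[OF G _ g] by blast
  ultimately show ?thesis
    unfolding homotopic_def using s(1,2)
    by (intro exI[of _ n] exI[of _ "\<lambda>i. compose (verts G) g (s i)"]) auto
qed

lemma homotopic_compose:
  assumes "is_graph G" "homotopic G H f f'" "homotopic H K g g'"
  shows "homotopic G K (compose (verts G) g f) (compose (verts G) g' f')"
proof (rule homotopic_trans)
  show "homotopic G K (compose (verts G) g f) (compose (verts G) g f')"
    using homotopic_compose_left assms homotopic_hom[OF assms(3)] by blast
  show "homotopic G K (compose (verts G) g f') (compose (verts G) g' f')"
    using homotopic_compose_right assms homotopic_hom[OF assms(2)] by blast
qed

lemma mem_homotopy_class_iff: "g \<in> homotopy_class G H f \<longleftrightarrow> homotopic G H f g"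
  by (simp add: homotopy_class_def homotopy_rel_def)

lemma homotopy_class_eq_iff:
  assumes "is_graph G" "is_graph H" "f \<in> graph_hom G H" "g \<in> graph_hom G H"
  shows "homotopy_class G H f = homotopy_class G H g \<longleftrightarrow> homotopic G H f g"
  using eq_equiv_class_iff[OF equiv_homotopy_rel[OF assms(1,2)] assms(3,4)]
  by (simp add: homotopy_class_def homotopy_rel_def)

lemma HoGph_Hom_class:
  "f \<in> graph_hom G H \<Longrightarrow> homotopy_class G H f \<in> Hom HoGph G H"
  by (auto simp: HoGph_def homotopy_class_def intro: quotientI)

lemma HoGph_Hom_cases:
  assumes "a \<in> Hom HoGph G H"
  obtains f where "f \<in> graph_hom G H" "a = homotopy_class G H f"
  using assms by (auto simp: HoGph_def homotopy_class_def elim: quotientE)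

lemma HoGph_Comp_class:
  assumes "is_graph G" "is_graph H" "is_graph K" "f \<in> graph_hom G H" "g \<in> graph_hom H K"
  shows "Comp HoGph G H K (homotopy_class H K g) (homotopy_class G H f) =
           homotopy_class G K (compose (verts G) g f)"
proof -
  have eq: "homotopy_class G K (compose (verts G) g' f') = homotopy_class G K (compose (verts G) g f)"
    if "f' \<in> homotopy_class G H f" "g' \<in> homotopy_class H K g" for f' g'
  proof -
    have h: "homotopic G K (compose (verts G) g f) (compose (verts G) g' f')"
      using that homotopic_compose[OF assms(1)] unfolding mem_homotopy_class_iff by blast
    show ?thesis
      using homotopy_class_eq_iff[OF assms(1,3) conjunct1[OF homotopic_hom[OF h]]
          conjunct2[OF homotopic_hom[OF h]]] h
      by (rule sym[OF iffD2])
  qed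
  have "homotopy_class G H f \<noteq> {}" "homotopy_class H K g \<noteq> {}"
    using assms(4,5) homotopic_refl mem_homotopy_class_iff by fastforce+
  then show ?thesis
    unfolding HoGph_def by (simp add: eq cong: SUP_cong_simp)
qed

lemma compose_id_right: "f \<in> graph_hom G H \<Longrightarrow> compose (verts G) f (\<lambda>v\<in>verts G. v) = f"
  by (auto simp: graph_hom_def PiE_iff extensional_def compose_def fun_eq_iff)

lemma compose_id_left: "f \<in> graph_hom G H \<Longrightarrow> compose (verts G) (\<lambda>v\<in>verts H. v) f = f"
  by (auto simp: graph_hom_def PiE_iff extensional_def compose_def fun_eq_iff)

lemma graph_hom_compose_assoc:
  "f \<in> graph_hom G H \<Longrightarrow>
     compose (verts G) (compose (verts H) h g) f = compose (verts G) h (compose (verts G) g f)"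
  by (auto simp: graph_hom_def PiE_iff compose_def fun_eq_iff)

lemma is_category_Gph: "is_category Gph"
  unfolding is_category_def Gph_def
  by (simp add: graph_hom_id graph_hom_compose compose_id_left compose_id_right
        graph_hom_compose_assoc)

lemma is_category_HoGph: "is_category HoGph"
proof -
  have Obj: "Obj HoGph = {G. is_graph G}"
    and Id: "\<And>G. Id HoGph G = homotopy_class G G (\<lambda>v\<in>verts G. v)"
    by (simp_all add: HoGph_def)
  show ?thesis
    unfolding is_category_def Obj Id
    by (auto elim!: HoGph_Hom_cases
          simp: HoGph_Comp_class HoGph_Hom_class graph_hom_id graph_hom_compose compose_id_left
                compose_id_right graph_hom_compose_assoc)
qed

lemma is_functor_Psi: "is_functor Gph HoGph Psi"
proof -
  have Obj: "Obj HoGph = {G. is_graph G}"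
    and Id: "\<And>G. Id HoGph G = homotopy_class G G (\<lambda>v\<in>verts G. v)"
    by (simp_all add: HoGph_def)
  show ?thesis
    unfolding is_functor_def Obj Id
    by (auto simp: Psi_def Gph_def PiE_iff extensional_def fun_eq_iff HoGph_Comp_class
          HoGph_Hom_class graph_hom_id graph_hom_compose)
qed

end

theory Submission
  imports Defs
begin

text \<open>
  Two morphisms \<open>f, g : G \<rightarrow> H\<close> that are adjacent in \<open>H\<^sup>G\<close> are the two ends \<open>h i\<^sub>0\<close>, \<open>h i\<^sub>1\<close> of
  one morphism \<open>h\<close> on the cylinder \<open>G \<times> I\<close>, where \<open>I\<close> is the looped edge. The projection
  \<open>p : G \<times> I \<rightarrow> G\<close> is a homotopy equivalence with \<open>p i\<^sub>0 = id = p i\<^sub>1\<close>, so \<open>F p\<close> is invertible,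
  \<open>F i\<^sub>0 = F i\<^sub>1\<close> and \<open>F f = F g\<close>. Hence \<open>F\<close> is constant on homotopy classes, and it factors
  uniquely because \<open>\<Psi>\<close> is bijective on objects and surjective on morphisms.
\<close>

section \<open>Cylinders\<close>

text \<open>The complement of a finite set in an infinite type is infinite, so it contains a set as
  large as \<open>V\<close>. This makes room for the top of a cylinder whose vertices stay in the
  type of \<open>V\<close>, so that the cylinder is an object of \<open>Gph\<close>.\<close>

lemma ex_disjoint_copy:
  assumes "infinite (UNIV :: 'a set)" "finite (V :: 'a set)"
  obtains e p :: "'a \<Rightarrow> 'a" where "\<And>v. v \<in> V \<Longrightarrow> e v \<notin> V" "\<And>v. v \<in> V \<Longrightarrow> p (e v) = v"
proof -
  have "infinite (- V)"
    using assms by (simp add: Compl_eq_Diff_UNIV)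
  then obtain U where U: "U \<subseteq> - V" "finite U" "card U = card V"
    by (meson infinite_arbitrarily_large)
  then obtain e where "bij_betw e V U"
    using finite_same_card_bij[OF assms(2)] by metis
  then have "inj_on e V" "e ` V = U"
    by (auto simp: bij_betw_def)
  with U that[of e "inv_into V e"] show thesis
    by auto
qed

lemma homotopic_edge:
  assumes "f \<in> graph_hom G H" "g \<in> graph_hom G H" "(f, g) \<in> edges (exp_graph H G)"
  shows "homotopic G H f g"
  using assms by (auto simp: homotopic_iff_rtrancl)

text \<open>
  The graph \<open>Z\<close> is a copy of \<open>G \<times> I\<close> inside the type \<^typ>\<open>'v\<close>: \<open>G\<close> itself is the bottom, and a
  disjoint copy of its vertices is the top.
\<close>

lemma ex_cylinder:
  fixes G :: "'v graph"
  assumes inf: "infinite (UNIV :: 'v set)" and G: "is_graph G"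
  obtains Z :: "'v graph" and p i0 i1 :: "'v \<Rightarrow> 'v" where "is_graph Z" "p \<in> graph_hom Z G"
    "i0 \<in> graph_hom G Z" "i1 \<in> graph_hom G Z" "homotopy_equivalence Z G p"
    "compose (verts G) p i0 = (\<lambda>v\<in>verts G. v)" "compose (verts G) p i1 = (\<lambda>v\<in>verts G. v)"
    "\<forall>H :: 'w graph. is_graph H \<longrightarrow> (\<forall>f\<in>graph_hom G H. \<forall>g\<in>graph_hom G H.
      (f, g) \<in> edges (exp_graph H G) \<longrightarrow>
      (\<exists>h\<in>graph_hom Z H. compose (verts G) h i0 = f \<and> compose (verts G) h i1 = g))"
proof -
  have "finite (verts G)"
    using G by (simp add: is_graph_def)
  then obtain e q where e: "\<And>v. v \<in> verts G \<Longrightarrow> e v \<notin> verts G" "\<And>v. v \<in> verts G \<Longrightarrow> q (e v) = v"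
    using ex_disjoint_copy[OF inf] by blast
  have Gv: "v \<in> verts G" "w \<in> verts G" if "(v, w) \<in> edges G" for v w
    using G that by (auto simp: is_graph_def)
  define W where "W = verts G \<union> e ` verts G"
  define p where "p = (\<lambda>x\<in>W. if x \<in> verts G then x else q x)"
  \<comment> \<open>Edges are pulled back along \<open>p\<close>. This is the edge rule of the
    product with a looped edge, since any two vertices of that edge are adjacent.\<close>
  define Z where "Z = \<lparr>verts = W, edges = {(x, y). x \<in> W \<and> y \<in> W \<and> (p x, p y) \<in> edges G}\<rparr>"
  define i0 where "i0 = (\<lambda>v\<in>verts G. v)"
  define i1 where "i1 = (\<lambda>v\<in>verts G. e v)"
  have pv: "p v = v" "p (e v) = v" if "v \<in> verts G" for v
    using that e by (auto simp: p_def W_def)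
  have Wv: "v \<in> W" "e v \<in> W" if "v \<in> verts G" for v
    using that by (auto simp: W_def)
  have pW: "p x \<in> verts G" if "x \<in> W" for x
    using that pv by (auto simp: W_def)
  have Z: "is_graph Z"
    using G by (auto simp: is_graph_def Z_def W_def sym_def)
  have p: "p \<in> graph_hom Z G"
    using pW by (auto simp: graph_hom_def Z_def PiE_iff extensional_def) (simp add: p_def)
  have i0: "i0 \<in> graph_hom G Z"
    by (auto simp: graph_hom_def Z_def i0_def Wv pv Gv)
  have i1: "i1 \<in> graph_hom G Z"
    by (auto simp: graph_hom_def Z_def i1_def Wv pv Gv)
  have pi: "compose (verts G) p i0 = (\<lambda>v\<in>verts G. v)" "compose (verts G) p i1 = (\<lambda>v\<in>verts G. v)"
    by (auto simp: compose_def i0_def i1_def pv fun_eq_iff)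
  have i0p: "compose (verts Z) i0 p \<in> graph_hom Z Z"
    using graph_hom_compose[OF Z p i0] .
  \<comment> \<open>Adjacency in \<open>Z\<close> depends only on values of \<open>p\<close>, and
    \<open>p i0 p = p\<close>. So collapsing the top onto the bottom is a single homotopy step from
    the identity.\<close>
  have "(compose (verts Z) i0 p, \<lambda>x\<in>verts Z. x) \<in> edges (exp_graph Z Z)"
    by (auto simp: exp_graph_def Z_def compose_def i0_def pW pv Wv)
  then have "homotopic Z Z (compose (verts Z) i0 p) (\<lambda>x\<in>verts Z. x)"
    using homotopic_edge[OF i0p graph_hom_id[OF Z]] by blast
  then have he: "homotopy_equivalence Z G p"
    unfolding homotopy_equivalence_def
    using p i0 pi(1) homotopic_refl[OF graph_hom_id[OF G]] by auto
  have "\<exists>h\<in>graph_hom Z H. compose (verts G) h i0 = f \<and> compose (verts G) h i1 = g"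
    if f: "f \<in> graph_hom G H" and g: "g \<in> graph_hom G H" and H: "is_graph H"
      and fg: "(f, g) \<in> edges (exp_graph H G)" for H :: "'w graph" and f g
  proof (intro bexI conjI)
    \<comment> \<open>The map is \<open>f\<close> on the bottom and \<open>g\<close> on the top. The
      four facts \<open>ed\<close> cover the possible levels of the two ends of an edge of
      \<open>Z\<close>.\<close>
    let ?h = "\<lambda>x\<in>W. if x \<in> verts G then f x else g (p x)"
    have ed: "(f v, f w) \<in> edges H" "(g v, g w) \<in> edges H" "(f v, g w) \<in> edges H"
      "(g v, f w) \<in> edges H" if "(v, w) \<in> edges G" for v w
    proof -
      show "(f v, f w) \<in> edges H" "(g v, g w) \<in> edges H" "(f v, g w) \<in> edges H"
        using f g fg that by (auto simp: graph_hom_def exp_graph_def)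
      \<comment> \<open>Adjacency of \<open>f\<close> and \<open>g\<close> puts \<open>f\<close>
        first. The reversed case follows by symmetry of both graphs.\<close>
      have "(w, v) \<in> edges G"
        using G that by (auto simp: is_graph_def dest: symD)
      then have "(f w, g v) \<in> edges H"
        using fg by (auto simp: exp_graph_def)
      then show "(g v, f w) \<in> edges H"
        using H by (auto simp: is_graph_def dest: symD)
    qed
    have val: "f v \<in> verts H" "g v \<in> verts H" if "v \<in> verts G" for v
      using f g that by (auto simp: graph_hom_def)
    have "(?h x, ?h y) \<in> edges H" if "x \<in> W" "y \<in> W" "(p x, p y) \<in> edges G" for x y
      using that ed[OF that(3)] pv(1) by (cases "x \<in> verts G"; cases "y \<in> verts G") auto
    then show "?h \<in> graph_hom Z H"
      using val pW by (auto simp: graph_hom_def Z_def)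
    show "compose (verts G) ?h i0 = f"
      using f by (auto simp: compose_def i0_def Wv fun_eq_iff graph_hom_def PiE_iff extensional_def)
    show "compose (verts G) ?h i1 = g"
      using g e by (auto simp: compose_def i1_def Wv pv fun_eq_iff graph_hom_def PiE_iff
          extensional_def)
  qed
  with Z p i0 i1 he pi that show thesis
    by simp
qed

section \<open>Functors inverting homotopy equivalences\<close>

text \<open>Composing with an inverse of \<open>f\<close> recovers \<open>a\<close> and
  \<open>b\<close>. It serves to cancel the image of the projection \<open>p\<close>.\<close>

lemma is_iso_cancel_left:
  assumes C: "is_category C" and "X \<in> Obj C" "Y \<in> Obj C" "Z \<in> Obj C"
    and f: "is_iso C Y Z f" and "a \<in> Hom C X Y" "b \<in> Hom C X Y"
    and eq: "Comp C X Y Z f a = Comp C X Y Z f b"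
  shows "a = b"
proof -
  obtain g where g: "g \<in> Hom C Z Y" "Comp C Y Z Y g f = Id C Y"
    using f by (auto simp: is_iso_def)
  have "Comp C X Z Y g (Comp C X Y Z f c) = c" if "c \<in> Hom C X Y" for c
  proof -
    have "Comp C X Z Y g (Comp C X Y Z f c) = Comp C X Y Y (Comp C Y Z Y g f) c"
      using assms that g(1) unfolding is_category_def is_iso_def by blast
    also have "\<dots> = c"
      using assms that g(2) unfolding is_category_def by simp
    finally show ?thesis .
  qed
  with assms(6,7) eq show ?thesis
    by metis
qed

lemma functor_GphD:
  assumes "is_functor Gph C F" "is_graph G" "is_graph H"
  shows "FObj F G \<in> Obj C"
    and "f \<in> graph_hom G H \<Longrightarrow> FArr F G H f \<in> Hom C (FObj F G) (FObj F H)"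
    and "FArr F G G (\<lambda>v\<in>verts G. v) = Id C (FObj F G)"
    and "is_graph K \<Longrightarrow> f \<in> graph_hom G H \<Longrightarrow> g \<in> graph_hom H K \<Longrightarrow>
      FArr F G K (compose (verts G) g f) =
        Comp C (FObj F G) (FObj F H) (FObj F K) (FArr F H K g) (FArr F G H f)"
  using assms by (auto simp: is_functor_def Gph_def PiE_iff)

text \<open>The cylinder settles a single edge of \<open>exp_graph H G\<close>, and induction along
  the chain of morphisms does the rest.\<close>

lemma FArr_homotopic_eq:
  fixes C :: "('o, 'm) category_data"
    and F :: "('v graph, 'v \<Rightarrow> 'v, 'o, 'm) functor_data"
  assumes inf: "infinite (UNIV :: 'v set)" and C: "is_category C" and F: "is_functor Gph C F"
    and iso: "\<And>G H f. is_graph G \<Longrightarrow> is_graph H \<Longrightarrow> homotopy_equivalence G H f \<Longrightarrow>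
           is_iso C (FObj F G) (FObj F H) (FArr F G H f)"
    and G: "is_graph G" and H: "is_graph H" and fg: "homotopic G H f g"
  shows "FArr F G H f = FArr F G H g"
proof -
  note FD = functor_GphD[OF F]
  obtain Z :: "'v graph" and p i0 i1 where Z: "is_graph Z" and p: "p \<in> graph_hom Z G"
    and i: "i0 \<in> graph_hom G Z" "i1 \<in> graph_hom G Z" and he: "homotopy_equivalence Z G p"
    and pi: "compose (verts G) p i0 = (\<lambda>v\<in>verts G. v)" "compose (verts G) p i1 = (\<lambda>v\<in>verts G. v)"
    and cyl: "\<forall>H :: 'v graph. is_graph H \<longrightarrow> (\<forall>f\<in>graph_hom G H. \<forall>g\<in>graph_hom G H.
      (f, g) \<in> edges (exp_graph H G) \<longrightarrow>
      (\<exists>h\<in>graph_hom Z H. compose (verts G) h i0 = f \<and> compose (verts G) h i1 = g))"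
    by (rule ex_cylinder[OF inf G])
  have "FArr F G Z i0 = FArr F G Z i1"
  proof (rule is_iso_cancel_left[OF C _ _ _ iso[OF Z G he]])
    show "Comp C (FObj F G) (FObj F Z) (FObj F G) (FArr F Z G p) (FArr F G Z i0) =
          Comp C (FObj F G) (FObj F Z) (FObj F G) (FArr F Z G p) (FArr F G Z i1)"
      using FD(4)[OF G Z G i(1) p] FD(4)[OF G Z G i(2) p] pi by simp
  qed (use FD(1,2) G Z i in auto)
  \<comment> \<open>With \<open>f = h i0\<close> and \<open>g = h i1\<close>, both images are the
    image of \<open>h\<close> composed with the common image of \<open>i0\<close> and
    \<open>i1\<close>.\<close>
  then have step: "FArr F G H f = FArr F G H g"
    if "f \<in> graph_hom G H" "g \<in> graph_hom G H" "(f, g) \<in> edges (exp_graph H G)" for f g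
    using cyl[rule_format, OF H that] FD(4)[OF G Z H] i by metis
  have "(f, g) \<in> (edges (exp_graph H G) \<inter> graph_hom G H \<times> graph_hom G H)\<^sup>*"
    using fg by (simp add: homotopic_iff_rtrancl)
  then show ?thesis
    by (induction rule: rtrancl_induct) (auto dest: step)
qed

text \<open>\<open>Psi\<close> is the identity on objects, and every morphism of
  \<open>HoGph\<close> is the class of a graph morphism. Elsewhere both functors are
  \<open>undefined\<close>.\<close>

lemma HoGph_functor_ext:
  fixes F1 F2 :: "('v graph, ('v \<Rightarrow> 'v) set, 'o, 'm) functor_data"
  assumes F1: "is_functor HoGph C F1" and F2: "is_functor HoGph C F2"
    and eq: "comp_functor Gph F1 Psi = comp_functor Gph F2 Psi"
  shows "F1 = F2"
proof (rule functor_data.equality)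
  have obj: "FObj F1 G = FObj F2 G" if "is_graph G" for G
    using fun_cong[OF arg_cong[OF eq, of FObj], of G] that
    by (simp add: comp_functor_def Psi_def Gph_def)
  have arr: "FArr F1 G H (homotopy_class G H f) = FArr F2 G H (homotopy_class G H f)"
    if "is_graph G" "is_graph H" "f \<in> graph_hom G H" for G H f
    using fun_cong[OF fun_cong[OF fun_cong[OF arg_cong[OF eq, of FArr], of G], of H], of f] that
    by (simp add: comp_functor_def Psi_def Gph_def)
  have Obj: "Obj HoGph = {G. is_graph G}"
    by (simp add: HoGph_def)
  show "FObj F1 = FObj F2"
    using F1 F2 by (intro PiE_ext[of _ "Obj HoGph"]) (auto simp: is_functor_def Obj obj)
  have "FArr F1 G H = FArr F2 G H" for G H
  proof (cases "is_graph G \<and> is_graph H")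
    case True
    \<comment> \<open>The codomain for \<open>F2\<close> is rewritten with \<open>obj\<close>, so
      that \<open>PiE_ext\<close> can compare both maps in one function space.\<close>
    then have "FArr F1 G H \<in> Hom HoGph G H \<rightarrow>\<^sub>E Hom C (FObj F1 G) (FObj F1 H)"
      "FArr F2 G H \<in> Hom HoGph G H \<rightarrow>\<^sub>E Hom C (FObj F1 G) (FObj F1 H)"
      using F1 F2 by (auto simp: is_functor_def Obj obj)
    then show ?thesis
      by (rule PiE_ext) (use True arr in \<open>auto elim!: HoGph_Hom_cases\<close>)
  next
    case False
    then show ?thesis
      using F1 F2 by (auto simp: is_functor_def Obj)
  qed
  then show "FArr F1 = FArr F2"
    by (simp add: fun_eq_iff)
qed simp

text \<open>By \<open>htpy\<close>, a class can be sent to the image under \<open>F\<close> of any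
  representative. The functor laws are then inherited from \<open>F\<close> through
  representatives.\<close>

lemma ex_HoGph_functor:
  fixes F :: "('v graph, 'v \<Rightarrow> 'v, 'o, 'm) functor_data"
  assumes F: "is_functor Gph C F"
    and htpy: "\<And>G H f g. is_graph G \<Longrightarrow> is_graph H \<Longrightarrow> homotopic G H f g \<Longrightarrow>
      FArr F G H f = FArr F G H g"
  shows "\<exists>F'. is_functor HoGph C F' \<and> comp_functor Gph F' Psi = F"
proof -
  note FD = functor_GphD[OF F]
  define F' :: "('v graph, ('v \<Rightarrow> 'v) set, 'o, 'm) functor_data" where
    "F' = \<lparr>FObj = FObj F,
           FArr = (\<lambda>G H a. if is_graph G \<and> is_graph H \<and> a \<in> Hom HoGph G H
                           then FArr F G H (SOME f. f \<in> a) else undefined)\<rparr>"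
  have Obj: "Obj HoGph = {G. is_graph G}"
    and Id: "\<And>G. Id HoGph G = homotopy_class G G (\<lambda>v\<in>verts G. v)"
    by (simp_all add: HoGph_def)
  have obj': "FObj F' = FObj F"
    by (simp add: F'_def)
  have arr': "FArr F' G H (homotopy_class G H f) = FArr F G H f"
    if G: "is_graph G" and H: "is_graph H" and f: "f \<in> graph_hom G H" for G H f
  proof -
    have "f \<in> homotopy_class G H f"
      using f by (simp add: mem_homotopy_class_iff homotopic_refl)
    then have "(SOME g. g \<in> homotopy_class G H f) \<in> homotopy_class G H f"
      by (rule someI[of "\<lambda>g. g \<in> homotopy_class G H f"])
    then show ?thesis
      using htpy[OF G H] G H HoGph_Hom_class[OF f] by (simp add: F'_def mem_homotopy_class_iff)
  qed
  have undef: "FArr F' G H a = undefined"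
    if "\<not> (is_graph G \<and> is_graph H \<and> a \<in> Hom HoGph G H)" for G H a
    unfolding F'_def using that by auto
  have objE: "FObj F \<in> {G. is_graph G} \<rightarrow>\<^sub>E Obj C"
    using F by (simp add: is_functor_def Gph_def)
  have "is_functor HoGph C F'"
    unfolding is_functor_def Obj Id obj'
    using objE
    by (auto simp: PiE_iff extensional_def undef arr' HoGph_Comp_class FD graph_hom_id
        graph_hom_compose elim!: HoGph_Hom_cases)
  moreover have "comp_functor Gph F' Psi = F"
  proof (rule functor_data.equality)
    show "FObj (comp_functor Gph F' Psi) = FObj F"
      using objE by (auto simp: comp_functor_def Psi_def Gph_def obj' fun_eq_iff PiE_iff
          extensional_def)
    \<comment> \<open>Equality of functor data also concerns arguments that are not morphisms, where
      the composite is \<open>undefined\<close> by definition.\<close>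
    have "FArr F G H f = undefined" if "\<not> (is_graph G \<and> is_graph H \<and> f \<in> graph_hom G H)" for G H f
    proof (cases "is_graph G \<and> is_graph H")
      case True
      then have "FArr F G H \<in> extensional (graph_hom G H)"
        using F by (simp add: is_functor_def Gph_def PiE_iff)
      with True that show ?thesis
        by (auto simp: extensional_def)
    next
      case False
      with F show ?thesis
        by (auto simp: is_functor_def Gph_def)
    qed
    then show "FArr (comp_functor Gph F' Psi) = FArr F"
      by (auto simp: comp_functor_def Psi_def Gph_def arr' fun_eq_iff)
  qed simp
  ultimately show ?thesis
    by blast
qed

theorem theorem5p1:
  fixes C :: "('o, 'm) category_data"
    and F :: "('v graph, 'v \<Rightarrow> 'v, 'o, 'm) functor_data"
  assumes "infinite (UNIV :: 'v set)"
    and "is_category C"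
    and "is_functor Gph C F"
    and "\<And>G H f. is_graph G \<Longrightarrow> is_graph H \<Longrightarrow> homotopy_equivalence G H f \<Longrightarrow>
           is_iso C (FObj F G) (FObj F H) (FArr F G H f)"
  shows "\<exists>!F'. is_functor HoGph C F' \<and> comp_functor Gph F' Psi = F"
proof -
  obtain F' where F': "is_functor HoGph C F'" "comp_functor Gph F' Psi = F"
    using ex_HoGph_functor[OF assms(3) FArr_homotopic_eq[OF assms]] by blast
  then show ?thesis
    by (intro ex1I[of _ F']) (auto intro: HoGph_functor_ext)
qed

end
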